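(* Let $V$ be a finite dimensional real vector space, $B\subseteq V$ a compact convex polyhedral $0$-neighborhood with associated asymmetric polyhedral norm $\nu$, and $\delta(u,v)=\nu(u-v)$. The normalized horofunctions of $V$ with respect to the asymmetric metric $\delta$ (and base point $0$) are precisely the maps $$u\longmapsto\nu(p-u)-\nu(p),$$ for $p\in V$, and the maps $$u\longmapsto\nu_L(p-u)-\nu_L(p),$$ for $p\in V$ and $L\subseteq K$ a dual face.
   Context: $V$ is a finite dimensional real vector space with dual $V^\vee$, endowed with a Euclidean norm $\|\cdot\|$, and $0$ is the base point. $B\subseteq V$ is a compact convex polyhedral neighborhood of $0$ with codimension-1 faces $A_0,\dots,A_m$, and $K=\{0,\dots,m\}$. For each $j\in K$, $\xi_j\in V^\vee$ is the unique linear functional with $A_j=\{v\in B\mid \xi_j(v)=1\}$; thus $B=\{u\in V\mid \xi_j(u)\le 1\text{ for all }j\in K\}$, and the asymmetric norm with unit ball $B$ is $\nu(u)=\max\{\xi_0(u),\dots,\xi_m(u)\}$. A nonempty subset $L\subseteq K$ is a dual face if there is $v\in V$ with $\nu(v)=1$ and $L=\{k\in K\mid \xi_k(v)=1\}$. For nonempty $L\subseteq K$, $\nu_L(u)=\max\{\xi_\ell(u)\mid \ell\in L\}$. The normalized horofunctions of $V$ with respect to $\delta$ are the elements of the bordification $\widehat V$, i.e. of the closure of $\{u\mapsto\delta(p,u)-\delta(p,0)\mid p\in V\}$ in the space of continuous functions $f:V\to\mathbb R$ with $f(0)=0$, in the topology of uniform convergence on bounded sets. *)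

theory Defs
  imports "HOL-Analysis.Analysis"
begin

definition pointed_continuous :: "('a::real_normed_vector \<Rightarrow> real) set" where
  "pointed_continuous = {f. continuous_on UNIV f \<and> f 0 = 0}"

text \<open>The topology of uniform convergence on bounded sets, on the space of continuous functions
  vanishing at the base point 0. Finite intersections of the basic neighbourhoods used here again
  contain a basic neighbourhood, because bounded sets are closed under finite unions.\<close>

definition bounded_uniform_open :: "('a::real_normed_vector \<Rightarrow> real) set \<Rightarrow> bool" where
  "bounded_uniform_open U \<longleftrightarrow> U \<subseteq> pointed_continuous \<and>
     (\<forall>f\<in>U. \<exists>S e. bounded S \<and> e > 0 \<and>
        {g \<in> pointed_continuous. \<forall>u\<in>S. \<bar>g u - f u\<bar> < e} \<subseteq> U)"

lemma istopology_bounded_uniform_open: "istopology bounded_uniform_open"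
proof -
  have int: "bounded_uniform_open (U \<inter> V)"
    if U: "bounded_uniform_open U" and V: "bounded_uniform_open V"
    for U V :: "('a \<Rightarrow> real) set"
    unfolding bounded_uniform_open_def
  proof (intro conjI ballI)
    show "U \<inter> V \<subseteq> pointed_continuous"
      using U by (auto simp: bounded_uniform_open_def)
  next
    fix f assume f: "f \<in> U \<inter> V"
    obtain S d where S: "bounded S" "d > 0"
      "{g \<in> pointed_continuous. \<forall>u\<in>S. \<bar>g u - f u\<bar> < d} \<subseteq> U"
      using U f unfolding bounded_uniform_open_def by blast
    obtain T e where T: "bounded T" "e > 0"
      "{g \<in> pointed_continuous. \<forall>u\<in>T. \<bar>g u - f u\<bar> < e} \<subseteq> V"
      using V f unfolding bounded_uniform_open_def by blast
    have "{g \<in> pointed_continuous. \<forall>u\<in>S \<union> T. \<bar>g u - f u\<bar> < min d e} \<subseteq> U \<inter> V"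
      using S(3) T(3) by auto
    moreover have "bounded (S \<union> T)" "min d e > 0"
      using S T by auto
    ultimately show "\<exists>S e. bounded S \<and> e > 0 \<and>
        {g \<in> pointed_continuous. \<forall>u\<in>S. \<bar>g u - f u\<bar> < e} \<subseteq> U \<inter> V"
      by blast
  qed
  have un: "bounded_uniform_open (\<Union>\<K>)"
    if K: "\<forall>U\<in>\<K>. bounded_uniform_open U" for \<K> :: "('a \<Rightarrow> real) set set"
    unfolding bounded_uniform_open_def
  proof (intro conjI ballI)
    show "\<Union>\<K> \<subseteq> pointed_continuous"
      using K by (auto simp: bounded_uniform_open_def)
  next
    fix f assume "f \<in> \<Union>\<K>"
    then obtain U where U: "U \<in> \<K>" "f \<in> U" by blast
    then have "bounded_uniform_open U"
      using K by simp
    then obtain S e where S: "bounded S" "e > 0"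
      "{g \<in> pointed_continuous. \<forall>u\<in>S. \<bar>g u - f u\<bar> < e} \<subseteq> U"
      using U(2) unfolding bounded_uniform_open_def by blast
    have "{g \<in> pointed_continuous. \<forall>u\<in>S. \<bar>g u - f u\<bar> < e} \<subseteq> \<Union>\<K>"
      by (rule subset_trans[OF S(3) Union_upper[OF U(1)]])
    with S(1,2) show "\<exists>S e. bounded S \<and> e > 0 \<and>
        {g \<in> pointed_continuous. \<forall>u\<in>S. \<bar>g u - f u\<bar> < e} \<subseteq> \<Union>\<K>"
      by (intro exI conjI)
  qed
  show ?thesis
    unfolding istopology_def using int un by blast
qed

definition bounded_uniform_topology :: "('a::real_normed_vector \<Rightarrow> real) topology" where
  "bounded_uniform_topology = topology bounded_uniform_open"

lemma openin_bounded_uniform_topology: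
  "openin bounded_uniform_topology U \<longleftrightarrow> bounded_uniform_open U"
  by (simp add: bounded_uniform_topology_def istopology_bounded_uniform_open)

lemma topspace_bounded_uniform_topology:
  "topspace bounded_uniform_topology = pointed_continuous"
proof -
  have whole: "bounded_uniform_open (pointed_continuous :: ('a \<Rightarrow> real) set)"
    unfolding bounded_uniform_open_def
  proof (intro conjI ballI subset_refl)
    fix f :: "'a \<Rightarrow> real"
    have "bounded ({} :: 'a set)" "(1::real) > 0"
      "{g \<in> pointed_continuous. \<forall>u\<in>{}. \<bar>g u - f u\<bar> < 1} \<subseteq> pointed_continuous"
      by auto
    then show "\<exists>S e. bounded S \<and> e > 0 \<and>
        {g \<in> pointed_continuous. \<forall>u\<in>S. \<bar>g u - f u\<bar> < e} \<subseteq> pointed_continuous"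
      by blast
  qed
  have "U \<subseteq> pointed_continuous" if "bounded_uniform_open U" for U :: "('a \<Rightarrow> real) set"
    using that by (simp add: bounded_uniform_open_def)
  with whole show ?thesis
    unfolding topspace_def openin_bounded_uniform_topology by blast
qed

text \<open>The bordification of the space with respect to \<open>\<delta>\<close> and base point 0. It includes the
  functions coming from points of the space, not only their limits at infinity.\<close>

definition normalized_horofunctions ::
    "('a::real_normed_vector \<Rightarrow> 'a \<Rightarrow> real) \<Rightarrow> ('a \<Rightarrow> real) set" where
  "normalized_horofunctions \<delta> =
     bounded_uniform_topology closure_of {(\<lambda>u. \<delta> p u - \<delta> p 0) |p. True}"

text \<open>For a nonempty finite index set \<open>L\<close>, this is \<open>\<nu>\<^sub>L\<close>; for the full index set it is \<open>\<nu>\<close>.\<close>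

definition polyhedral_norm :: "(nat \<Rightarrow> 'a \<Rightarrow> real) \<Rightarrow> nat set \<Rightarrow> 'a \<Rightarrow> real" where
  "polyhedral_norm \<xi> L u = Max ((\<lambda>l. \<xi> l u) ` L)"

definition asym_metric :: "('a::real_vector \<Rightarrow> real) \<Rightarrow> 'a \<Rightarrow> 'a \<Rightarrow> real" where
  "asym_metric \<nu> u v = \<nu> (u - v)"

definition dual_face :: "(nat \<Rightarrow> 'a \<Rightarrow> real) \<Rightarrow> nat set \<Rightarrow> nat set \<Rightarrow> bool" where
  "dual_face \<xi> K L \<longleftrightarrow> L \<noteq> {} \<and> L \<subseteq> K \<and>
     (\<exists>v. polyhedral_norm \<xi> K v = 1 \<and> L = {k \<in> K. \<xi> k v = 1})"

end

theory Submission
  imports Defs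
begin

text \<open>Write \<open>\<nu> (p - u) - \<nu> p = max\<^sub>k (c\<^sub>k - \<xi>\<^sub>k u)\<close> with \<open>c\<^sub>k = \<xi>\<^sub>k p - \<nu> p \<le> 0\<close>. Along a sequence
  \<open>p\<^sub>n\<close>, after passing to a subsequence each \<open>c\<^sub>k\<close> converges or tends to \<open>-\<infinity>\<close>; only the set \<open>L\<close> of
  indices with finite limit contributes to the limit function. Projecting \<open>(p\<^sub>n, \<nu> p\<^sub>n)\<close> to the span
  of the functionals \<open>(a, t) \<mapsto> \<xi>\<^sub>k a - t\<close> for \<open>k \<in> L\<close> gives a bounded sequence, whose limit supplies
  the parameter \<open>p\<close>, and the remainder of this projection, suitably normalized, exhibits \<open>L\<close> as a dual
  face unless \<open>L = K\<close>. Conversely, if \<open>v\<close> defines the dual face \<open>L\<close>, then the functions of the points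
  \<open>p + t v\<close> agree with that of \<open>(p, L)\<close> on any given bounded set once \<open>t\<close> is large.\<close>

section \<open>Closure for uniform convergence on bounded sets\<close>

lemma closure_of_bounded_uniform_topology:
  "f \<in> bounded_uniform_topology closure_of G \<longleftrightarrow> f \<in> pointed_continuous \<and>
     (\<forall>S e. bounded S \<longrightarrow> e > 0 \<longrightarrow> (\<exists>g\<in>G \<inter> pointed_continuous. \<forall>u\<in>S. \<bar>g u - f u\<bar> < e))"
  (is "?lhs \<longleftrightarrow> ?rhs")
proof
  assume lhs: ?lhs
  then have f: "f \<in> pointed_continuous"
    by (simp add: in_closure_of topspace_bounded_uniform_topology)
  have "\<exists>g\<in>G \<inter> pointed_continuous. \<forall>u\<in>S. \<bar>g u - f u\<bar> < e" if "bounded S" "e > 0" for S e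
  proof -
    \<comment> \<open>The set cut out by the strict pointwise bound \<open>< e\<close> need not be
      open, since the difference may approach \<open>e\<close> along \<open>S\<close>. One uniform
      margin \<open>d < e\<close> repairs this: it leaves room \<open>e - d\<close>, half of which
      serves as a radius around \<open>g\<close>.\<close>
    let ?U = "{g \<in> pointed_continuous. \<exists>d<e. \<forall>u\<in>S. \<bar>g u - f u\<bar> \<le> d}"
    have "bounded_uniform_open ?U"
      unfolding bounded_uniform_open_def
    proof (intro conjI ballI)
      fix g assume "g \<in> ?U"
      then obtain d where d: "d < e" "\<forall>u\<in>S. \<bar>g u - f u\<bar> \<le> d" by blast
      have "h \<in> ?U" if h: "h \<in> pointed_continuous" "\<forall>u\<in>S. \<bar>h u - g u\<bar> < (e - d) / 2" for h
      proof -
        have "\<bar>h u - f u\<bar> \<le> (e + d) / 2" if "u \<in> S" for u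
          using d(2)[rule_format, OF that] h(2)[rule_format, OF that]
          unfolding less_divide_eq le_divide_eq by (simp add: abs_if split: if_splits)
        moreover have "(e + d) / 2 < e" using d by simp
        ultimately show ?thesis using h(1) by blast
      qed
      then show "\<exists>T r. bounded T \<and> r > 0 \<and>
          {h \<in> pointed_continuous. \<forall>u\<in>T. \<bar>h u - g u\<bar> < r} \<subseteq> ?U"
        using \<open>bounded S\<close> d(1) by (intro exI[of _ S] exI[of _ "(e - d) / 2"]) auto
    qed auto
    then have "openin bounded_uniform_topology ?U"
      by (simp add: openin_bounded_uniform_topology)
    moreover have "f \<in> ?U"
      using f \<open>e > 0\<close> by auto
    ultimately have "\<exists>g. g \<in> G \<and> g \<in> ?U"
      by (intro lhs[unfolded in_closure_of, THEN conjunct2, rule_format] conjI)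
    then obtain g where g: "g \<in> G" "g \<in> ?U" by (elim exE conjE)
    then obtain d where "d < e" "\<forall>u\<in>S. \<bar>g u - f u\<bar> \<le> d" by blast
    then have "\<forall>u\<in>S. \<bar>g u - f u\<bar> < e" by (meson le_less_trans)
    then show ?thesis using g by blast
  qed
  then show ?rhs using f by blast
next
  assume rhs: ?rhs
  have "\<exists>g. g \<in> G \<and> g \<in> U" if U: "f \<in> U" "bounded_uniform_open U" for U
  proof -
    obtain S e where "bounded S" "e > 0" "{g \<in> pointed_continuous. \<forall>u\<in>S. \<bar>g u - f u\<bar> < e} \<subseteq> U"
      using U unfolding bounded_uniform_open_def by blast
    moreover from this obtain g where "g \<in> G \<inter> pointed_continuous" "\<forall>u\<in>S. \<bar>g u - f u\<bar> < e"
      using rhs by meson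
    ultimately show ?thesis by blast
  qed
  then show ?lhs
    using rhs by (auto simp: in_closure_of topspace_bounded_uniform_topology
        openin_bounded_uniform_topology)
qed

section \<open>Maxima, bounded representatives and subsequences\<close>

lemma tendsto_Max_image:
  fixes f :: "'i \<Rightarrow> 'b \<Rightarrow> real"
  assumes "finite L" "L \<noteq> {}" "\<And>k. k \<in> L \<Longrightarrow> (f k \<longlongrightarrow> l k) F"
  shows "((\<lambda>x. Max ((\<lambda>k. f k x) ` L)) \<longlongrightarrow> Max (l ` L)) F"
  using assms by (induction L rule: finite_ne_induct) (auto intro!: tendsto_max)

text \<open>Projecting \<open>z\<close> orthogonally to the span of the vectors representing the
  functionals keeps all values \<open>\<eta> k z\<close>. On that span the values determine the
  vector, so in finite dimension they also control its norm, with \<open>C\<close> independent of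
  \<open>z\<close>. An unbounded sequence with bounded values can thus be traded for a bounded one
  with the same values.\<close>

lemma bounded_preimage_of_functionals:
  fixes \<eta> :: "'i \<Rightarrow> 'b::euclidean_space \<Rightarrow> real"
  assumes "finite L" and lin: "\<And>k. k \<in> L \<Longrightarrow> linear (\<eta> k)"
  obtains C where "\<And>z. \<exists>y. (\<forall>k\<in>L. \<eta> k y = \<eta> k z) \<and> norm y \<le> C * (\<Sum>k\<in>L. \<bar>\<eta> k z\<bar>)"
proof -
  define w where "w k = adjoint (\<eta> k) 1" for k
  have w: "\<eta> k y = y \<bullet> w k" if "k \<in> L" for k y
    using adjoint_works[OF lin[OF that], of y 1] by (simp add: w_def)
  define W where "W = span (w ` L)"
  \<comment> \<open>\<open>T\<close> is the Gram operator of the \<open>w k\<close>. It depends on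
    \<open>y\<close> only through the values \<open>y \<bullet> w k\<close>, and
    \<open>y \<bullet> T y\<close> is the sum of their squares, which makes \<open>T\<close>
    injective on \<open>W\<close>.\<close>
  define T where "T y = (\<Sum>k\<in>L. (y \<bullet> w k) *\<^sub>R w k)" for y
  have T: "bounded_linear T"
    unfolding T_def by (intro bounded_linear_intros)
  have "y = 0" if "y \<in> W" "T y = 0" for y
  proof -
    have "(\<Sum>k\<in>L. (y \<bullet> w k)\<^sup>2) = y \<bullet> T y"
      by (simp add: T_def inner_sum_right power2_eq_square)
    then have "\<forall>k\<in>L. y \<bullet> w k = 0"
      using \<open>finite L\<close> that by (simp add: sum_nonneg_eq_0_iff)
    then have "orthogonal y y"
      by (intro orthogonal_to_span[OF that(1)[unfolded W_def]]) (auto simp: orthogonal_def)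
    then show ?thesis by (simp add: orthogonal_self)
  qed
  then obtain e where e: "e > 0" "\<And>y. y \<in> W \<Longrightarrow> e * norm y \<le> norm (T y)"
    using injective_imp_isometric[OF _ _ T, of W] closed_span subspace_span
    unfolding W_def by (metis mult.commute)
  define D where "D = (\<Sum>k\<in>L. norm (w k))"
  have "\<exists>y. (\<forall>k\<in>L. \<eta> k y = \<eta> k z) \<and> norm y \<le> (D / e) * (\<Sum>k\<in>L. \<bar>\<eta> k z\<bar>)" for z
  proof -
    obtain y x where y: "y \<in> W" and x: "\<And>v. v \<in> W \<Longrightarrow> orthogonal x v" and z: "z = y + x"
      using orthogonal_subspace_decomp_exists[of "w ` L" z] unfolding W_def by metis
    have eq: "\<eta> k y = \<eta> k z" if "k \<in> L" for k
      using x[of "w k"] that by (auto simp: w z inner_add_left orthogonal_def W_def span_base)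
    have "norm (T y) \<le> (\<Sum>k\<in>L. \<bar>\<eta> k z\<bar> * norm (w k))"
      unfolding T_def by (rule order_trans[OF norm_sum]) (auto intro!: sum_mono simp: w[symmetric] eq)
    also have "\<dots> \<le> (\<Sum>k\<in>L. \<bar>\<eta> k z\<bar> * D)"
      unfolding D_def using \<open>finite L\<close>
      by (intro sum_mono mult_left_mono member_le_sum) auto
    finally have "e * norm y \<le> D * (\<Sum>k\<in>L. \<bar>\<eta> k z\<bar>)"
      using e(2)[OF y] by (simp add: sum_distrib_left mult.commute)
    then have "norm y \<le> (D / e) * (\<Sum>k\<in>L. \<bar>\<eta> k z\<bar>)"
      using e(1) by (simp add: field_simps)
    then show ?thesis using eq by blast
  qed
  then show ?thesis by (rule that)
qed

text \<open>The extended reals are sequentially compact, so finitely many successive extractions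
  suffice. Divergence to infinity counts as convergence here, which is why the values are in
  \<open>ereal\<close>.\<close>

lemma ereal_simultaneous_subsequence:
  fixes c :: "nat \<Rightarrow> 'i \<Rightarrow> ereal"
  assumes "finite K"
  obtains r l where "strict_mono r" "\<And>k. k \<in> K \<Longrightarrow> (\<lambda>n. c (r n) k) \<longlonglongrightarrow> l k"
proof -
  have "\<exists>r l. strict_mono (r :: nat \<Rightarrow> nat) \<and> (\<forall>k\<in>K. (\<lambda>n. c (r n) k) \<longlonglongrightarrow> l k)"
    using assms
  proof (induction K rule: finite_induct)
    case empty
    show ?case using strict_mono_id by blast
  next
    case (insert i K)
    then obtain r l where r: "strict_mono (r :: nat \<Rightarrow> nat)" "\<forall>k\<in>K. (\<lambda>n. c (r n) k) \<longlonglongrightarrow> l k"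
      by blast
    obtain a s where s: "strict_mono s" "((\<lambda>n. c (r n) i) \<circ> s) \<longlonglongrightarrow> a"
      using compact_complete_linorder[of "\<lambda>n. c (r n) i"] by blast
    have "(\<lambda>n. c ((r \<circ> s) n) k) \<longlonglongrightarrow> (l(i := a)) k" if "k \<in> insert i K" for k
    proof (cases "k = i")
      case True
      then show ?thesis using s(2) by (simp add: o_def)
    next
      case False
      then show ?thesis
        using LIMSEQ_subseq_LIMSEQ[OF _ s(1), of "\<lambda>n. c (r n) k" "l k"] r(2) that
        by (simp add: o_def)
    qed
    then show ?case using strict_mono_o[OF r(1) s(1)] by blast
  qed
  then show ?thesis using that by blast
qed

section \<open>Polyhedral norms\<close>

lemma polyhedral_norm_ge: "finite L \<Longrightarrow> l \<in> L \<Longrightarrow> \<xi> l u \<le> polyhedral_norm \<xi> L u"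
  by (simp add: polyhedral_norm_def)

lemma polyhedral_norm_attained:
  assumes "finite L" "L \<noteq> {}"
  obtains l where "l \<in> L" "\<xi> l u = polyhedral_norm \<xi> L u"
  using Max_in[of "(\<lambda>l. \<xi> l u) ` L"] assms unfolding polyhedral_norm_def by fastforce

lemma Max_image_add_polyhedral_norm:
  "finite L \<Longrightarrow> L \<noteq> {} \<Longrightarrow> (MAX l\<in>L. \<xi> l u + t) = polyhedral_norm \<xi> L u + t"
  unfolding polyhedral_norm_def by (rule Max_add_commute)

lemma continuous_polyhedral_norm:
  fixes \<xi> :: "nat \<Rightarrow> 'a::euclidean_space \<Rightarrow> real"
  assumes "finite L" "L \<noteq> {}" "\<And>k. k \<in> L \<Longrightarrow> linear (\<xi> k)"
  shows "continuous_on UNIV (polyhedral_norm \<xi> L)"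
  unfolding polyhedral_norm_def continuous_on_def
  using assms linear_continuous_on[of _ UNIV]
  by (intro ballI tendsto_Max_image) (auto simp: continuous_on_def linear_conv_bounded_linear)

lemma Max_image_eq_subset:
  fixes a :: "'i \<Rightarrow> real"
  assumes "finite K" "L \<subseteq> K" "l \<in> L" "\<And>k. k \<in> K - L \<Longrightarrow> a k \<le> a l"
  shows "Max (a ` K) = Max (a ` L)"
proof (rule antisym)
  have fin: "finite L" using assms finite_subset by blast
  have "a k \<le> Max (a ` L)" if "k \<in> K" for k
  proof (cases "k \<in> L")
    case False
    then have "a k \<le> a l" using assms that by blast
    also have "\<dots> \<le> Max (a ` L)" using assms fin by simp
    finally show ?thesis .
  qed (use fin in auto)
  then show "Max (a ` K) \<le> Max (a ` L)" using assms by (intro Max.boundedI) auto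
  show "Max (a ` L) \<le> Max (a ` K)" using assms by (intro Max_mono) auto
qed

section \<open>From dual faces to horofunctions\<close>

text \<open>Moving from \<open>p\<close> by \<open>t\<close> along a point \<open>v\<close> defining
  \<open>L\<close> raises the functionals in \<open>L\<close> by exactly \<open>t\<close> and the
  others by strictly less. Over a bounded set the former attain the maximum once \<open>t\<close> is
  large, so the agreement is exact and not just approximate.\<close>

lemma horofunction_of_dual_face:
  fixes \<xi> :: "nat \<Rightarrow> 'a::euclidean_space \<Rightarrow> real"
  assumes "finite K" and lin: "\<And>k. k \<in> K \<Longrightarrow> linear (\<xi> k)"
    and L: "dual_face \<xi> K L" and S: "bounded S"
  obtains q where "\<And>u. u \<in> S \<Longrightarrow> polyhedral_norm \<xi> K (q - u) - polyhedral_norm \<xi> K q =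
      polyhedral_norm \<xi> L (p - u) - polyhedral_norm \<xi> L p"
proof -
  obtain v where L: "L \<noteq> {}" "L \<subseteq> K" and v: "polyhedral_norm \<xi> K v = 1" "L = {k \<in> K. \<xi> k v = 1}"
    using L by (auto simp: dual_face_def)
  have finL: "finite L" using L \<open>finite K\<close> finite_subset by blast
  have less: "\<xi> k v < 1" if "k \<in> K - L" for k
    using polyhedral_norm_ge[OF \<open>finite K\<close>, of k \<xi> v] v that by fastforce
  \<comment> \<open>The point 0 is adjoined so that the shift formula also covers the normalizing
    term.\<close>
  define S' where "S' = insert 0 S"
  have "bounded (\<Union>k\<in>K. \<xi> k ` (\<lambda>u. p - u) ` S')"
    unfolding S'_def using \<open>finite K\<close> lin S
    by (intro bounded_UN ballI bounded_linear_image[where S = "(\<lambda>u. p - u) ` insert 0 S"]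
        bounded_minus_comp)
      (auto simp: linear_conv_bounded_linear image_constant_conv)
  then obtain M where M: "\<And>k u. k \<in> K \<Longrightarrow> u \<in> S' \<Longrightarrow> \<bar>\<xi> k (p - u)\<bar> \<le> M"
    unfolding bounded_real by blast
  have "M \<ge> 0" using M[of _ 0] L unfolding S'_def by (meson abs_ge_zero all_not_in_conv in_mono insertI1 order_trans)
  \<comment> \<open>Each summand is the threshold for one index outside \<open>L\<close>. All are
    nonnegative, so the sum exceeds each of them, and it makes sense even if there are none.\<close>
  define t where "t = (\<Sum>k\<in>K - L. 2 * M / (1 - \<xi> k v))"
  have t: "2 * M \<le> t * (1 - \<xi> k v)" if "k \<in> K - L" for k
  proof -
    have "2 * M / (1 - \<xi> k v) \<le> t"
      unfolding t_def using that \<open>finite K\<close> \<open>M \<ge> 0\<close> less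
      by (intro member_le_sum) (auto intro!: divide_nonneg_pos)
    then show ?thesis using less[OF that] by (simp add: field_simps)
  qed
  have shift: "polyhedral_norm \<xi> K (p + t *\<^sub>R v - u) = polyhedral_norm \<xi> L (p - u) + t"
    if "u \<in> S'" for u
  proof -
    have eq: "\<xi> k (p + t *\<^sub>R v - u) = \<xi> k (p - u) + t * \<xi> k v" if "k \<in> K" for k
      using lin[OF that] by (simp add: linear_add linear_diff linear_cmul)
    obtain l where l: "l \<in> L" using L by blast
    \<comment> \<open>The values at \<open>p - u\<close> differ by at most \<open>2 * M\<close>,
      which the gap \<open>t * (1 - \<xi> k v)\<close> absorbs.\<close>
    have "\<xi> k (p - u) + t * \<xi> k v \<le> \<xi> l (p - u) + t * \<xi> l v" if "k \<in> K - L" for k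
      using M[of k u] M[of l u] t[of k] that L l v(2) \<open>u \<in> S'\<close> by (auto simp: algebra_simps abs_le_iff)
    then have "polyhedral_norm \<xi> K (p + t *\<^sub>R v - u) = polyhedral_norm \<xi> L (p + t *\<^sub>R v - u)"
      unfolding polyhedral_norm_def using L l eq
      by (intro Max_image_eq_subset[OF \<open>finite K\<close> _ l]) auto
    also have "\<dots> = (MAX k\<in>L. \<xi> k (p - u) + t)"
      unfolding polyhedral_norm_def using eq v L by (intro arg_cong[where f = Max] image_cong) auto
    also have "\<dots> = polyhedral_norm \<xi> L (p - u) + t"
      by (rule Max_image_add_polyhedral_norm[OF finL L(1)])
    finally show ?thesis .
  qed
  show ?thesis
    using that[of "p + t *\<^sub>R v"] shift shift[of 0] by (simp add: S'_def)
qed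

section \<open>From limits to dual faces\<close>

text \<open>The defining point is \<open>a\<close> divided by \<open>t\<close>, so the matter is
  that \<open>t\<close> is positive. If \<open>a\<close> is nonzero, some functional is positive at
  \<open>a\<close> and bounded by \<open>t\<close>; if \<open>a = 0\<close>, an index outside
  \<open>L\<close> gives \<open>0 < t\<close>, and this is where \<open>L\<close> must be
  proper.\<close>

lemma dual_faceI_strict:
  fixes \<xi> :: "nat \<Rightarrow> 'a::euclidean_space \<Rightarrow> real"
  assumes "finite K" and lin: "\<And>k. k \<in> K \<Longrightarrow> linear (\<xi> k)"
    and pos: "\<And>a. a \<noteq> 0 \<Longrightarrow> \<exists>k\<in>K. \<xi> k a > 0"
    and L: "L \<noteq> {}" "L \<subset> K"
    and eq: "\<And>k. k \<in> L \<Longrightarrow> \<xi> k a = t" and less: "\<And>k. k \<in> K - L \<Longrightarrow> \<xi> k a < t"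
  shows "dual_face \<xi> K L"
proof -
  obtain j where j: "j \<in> K - L" using L by blast
  have "t > 0"
  proof (cases "a = 0")
    case True
    then show ?thesis using less[OF j] lin j linear_0 by fastforce
  next
    case False
    then show ?thesis using pos[OF False] eq less by (metis DiffI less_trans)
  qed
  define v where "v = (1 / t) *\<^sub>R a"
  have val: "\<xi> k v = \<xi> k a / t" if "k \<in> K" for k
    using lin[OF that] by (simp add: v_def linear_cmul)
  obtain l where l: "l \<in> L" using L by blast
  have "L = {k \<in> K. \<xi> k v = 1}"
    using val eq less L \<open>t > 0\<close> by force
  moreover have "\<xi> k v \<le> 1" if "k \<in> K" for k
    using val[OF that] eq[of k] less[of k] that \<open>t > 0\<close> by (cases "k \<in> L") auto
  then have "polyhedral_norm \<xi> K v = 1"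
    unfolding polyhedral_norm_def using \<open>finite K\<close> l L calculation
    by (intro Max_eqI) (auto simp: image_iff)
  ultimately show ?thesis using L unfolding dual_face_def by blast
qed

lemma horofunction_limit:
  fixes \<xi> :: "nat \<Rightarrow> 'a::euclidean_space \<Rightarrow> real"
  assumes "finite K" "K \<noteq> {}" and lin: "\<And>k. k \<in> K \<Longrightarrow> linear (\<xi> k)"
    and pos: "\<And>a. a \<noteq> 0 \<Longrightarrow> \<exists>k\<in>K. \<xi> k a > 0"
    and lim: "\<And>u. (\<lambda>n. polyhedral_norm \<xi> K (p n - u) - polyhedral_norm \<xi> K (p n)) \<longlonglongrightarrow> f u"
  obtains q L where "L = K \<or> dual_face \<xi> K L"
    "f = (\<lambda>u. polyhedral_norm \<xi> L (q - u) - polyhedral_norm \<xi> L q)"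
proof -
  define c where "c n k = \<xi> k (p n) - polyhedral_norm \<xi> K (p n)" for n k
  have c_le: "c n k \<le> 0" if "k \<in> K" for n k
    using polyhedral_norm_ge[OF \<open>finite K\<close> that] by (simp add: c_def)
  obtain r l where r: "strict_mono r" and l: "\<And>k. k \<in> K \<Longrightarrow> (\<lambda>n. ereal (c (r n) k)) \<longlonglongrightarrow> l k"
    using ereal_simultaneous_subsequence[OF \<open>finite K\<close>, of "\<lambda>n k. ereal (c n k)"] by metis
  define L where "L = {k \<in> K. l k \<noteq> -\<infinity>}"
  have "L \<subseteq> K" "finite L" using \<open>finite K\<close> by (auto simp: L_def)
  have fin: "(\<lambda>n. c (r n) k) \<longlonglongrightarrow> real_of_ereal (l k)" if "k \<in> L" for k
  proof -
    have "l k \<le> 0" "k \<in> K" "l k \<noteq> -\<infinity>"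
      using that c_le by (auto simp: L_def intro!: LIMSEQ_le_const2[OF l])
    then have "\<bar>l k\<bar> \<noteq> \<infinity>" by auto
    then have "ereal (real_of_ereal (l k)) = l k" by (rule ereal_real')
    then show ?thesis using l[OF \<open>k \<in> K\<close>] by (metis lim_ereal)
  qed
  have inf: "filterlim (\<lambda>n. c (r n) k) at_bot sequentially" if "k \<in> K - L" for k
    using l[of k] that unfolding L_def 
    by (simp add: tendsto_MInfty filterlim_at_bot_dense)

  \<comment> \<open>The subtracted norm becomes an extra coordinate: \<open>c n k\<close> is the
    value of the linear functional \<open>\<eta> k\<close> at
    \<open>(p n, polyhedral_norm \<xi> K (p n))\<close>, so linear algebra applies to the normalized
    values.\<close>
  define \<eta> where "\<eta> k z = \<xi> k (fst z) - snd z" for k and z :: "'a \<times> real"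
  have \<eta>: "linear (\<eta> k)" if "k \<in> K" for k
    using lin[OF that] by (auto simp: \<eta>_def linear_iff algebra_simps)
  obtain C where C: "\<And>z. \<exists>y. (\<forall>k\<in>L. \<eta> k y = \<eta> k z) \<and> norm y \<le> C * (\<Sum>k\<in>L. \<bar>\<eta> k z\<bar>)"
    using bounded_preimage_of_functionals[OF \<open>finite L\<close>, of \<eta>] \<eta> \<open>L \<subseteq> K\<close> by blast
  have "\<exists>y. (\<forall>k\<in>L. \<eta> k y = c n k) \<and> norm y \<le> C * (\<Sum>k\<in>L. \<bar>c n k\<bar>)" for n
  proof -
    have "\<eta> k (p n, polyhedral_norm \<xi> K (p n)) = c n k" for k
      by (simp add: \<eta>_def c_def)
    with C[of "(p n, polyhedral_norm \<xi> K (p n))"] show ?thesis by simp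
  qed
  then obtain y where y: "\<And>n k. k \<in> L \<Longrightarrow> \<eta> k (y n) = c n k"
      "\<And>n. norm (y n) \<le> C * (\<Sum>k\<in>L. \<bar>c n k\<bar>)"
    by metis
  \<comment> \<open>Along \<open>r\<close> all values with index in \<open>L\<close> have finite
    limits, which bounds the representatives \<open>y (r n)\<close> and permits a second extraction
    \<open>s\<close>.\<close>
  have "convergent (\<lambda>n. C * (\<Sum>k\<in>L. \<bar>c (r n) k\<bar>))"
    by (rule convergentI[OF tendsto_mult[OF tendsto_const tendsto_sum[OF tendsto_rabs[OF fin]]]])
  then have "Bseq (\<lambda>n. C * (\<Sum>k\<in>L. \<bar>c (r n) k\<bar>))"
    by (rule convergent_imp_Bseq)
  then have "Bseq (\<lambda>n. y (r n))"
    by (rule Bseq_eventually_mono[rotated])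
      (simp add: order_trans[OF y(2) abs_ge_self] always_eventually)
  then have "bounded (range (\<lambda>n. y (r n)))" by (simp add: Bseq_eq_bounded)
  then obtain z s where s: "strict_mono s" "((\<lambda>n. y (r n)) \<circ> s) \<longlonglongrightarrow> z"
    using bounded_imp_convergent_subsequence by blast
  define R where "R = r \<circ> s"
  have R: "strict_mono R" using strict_mono_o[OF r s(1)] by (simp add: R_def)
  have \<eta>_lim: "(\<lambda>n. \<eta> k (y (R n))) \<longlonglongrightarrow> \<eta> k z" if "k \<in> K" for k
    using bounded_linear.tendsto[OF \<eta>[OF that, unfolded linear_conv_bounded_linear] s(2)]
    by (simp add: R_def o_def)
  have fin: "(\<lambda>n. c (R n) k) \<longlonglongrightarrow> \<eta> k z" if "k \<in> L" for k
    using \<eta>_lim[of k] y(1)[OF that] that \<open>L \<subseteq> K\<close> by auto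
  have inf: "filterlim (\<lambda>n. c (R n) k) at_bot sequentially" if "k \<in> K - L" for k
    using filterlim_compose[OF inf[OF that] filterlim_subseq[OF s(1)]] by (simp add: R_def)
  \<comment> \<open>Indices outside \<open>L\<close> eventually drop below any prescribed thresholds
    simultaneously. This serves three times: for \<open>L \<noteq> {}\<close>, for discarding these
    indices from the maximum, and for the strict inequalities defining the face.\<close>
  have below: "\<forall>\<^sub>F n in sequentially. \<forall>k\<in>K - L. c (R n) k < b k" for b
    using inf \<open>finite K\<close> by (intro eventually_ball_finite) (simp_all add: filterlim_at_bot_dense)

  \<comment> \<open>At every \<open>n\<close> the maximum is attained, so some \<open>c n k\<close>
    is 0 and not all can tend to minus infinity.\<close>
  have "L \<noteq> {}"
  proof
    assume "L = {}"
    then obtain n where n: "\<forall>k\<in>K. c (R n) k < 0"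
      using eventually_happens[OF below[of "\<lambda>_. 0"]] by auto
    obtain k where "k \<in> K" "\<xi> k (p (R n)) = polyhedral_norm \<xi> K (p (R n))"
      by (rule polyhedral_norm_attained[OF \<open>finite K\<close> \<open>K \<noteq> {}\<close>])
    then show False using n by (auto simp: c_def)
  qed
  then obtain l0 where l0: "l0 \<in> L" by blast

  have f: "f u = polyhedral_norm \<xi> L (fst z - u) - snd z" for u
  proof (rule LIMSEQ_unique)
    show "(\<lambda>n. polyhedral_norm \<xi> K (p (R n) - u) - polyhedral_norm \<xi> K (p (R n))) \<longlonglongrightarrow> f u"
      using LIMSEQ_subseq_LIMSEQ[OF lim R] by (simp add: o_def)
    have "polyhedral_norm \<xi> K (p n - u) - polyhedral_norm \<xi> K (p n) = (MAX k\<in>K. c n k - \<xi> k u)" for n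
    proof -
      have "(MAX k\<in>K. c n k - \<xi> k u) = (MAX k\<in>K. \<xi> k (p n - u) + - polyhedral_norm \<xi> K (p n))"
        using lin by (intro arg_cong[where f = Max] image_cong) (auto simp: c_def linear_diff)
      then show ?thesis
        unfolding Max_image_add_polyhedral_norm[OF \<open>finite K\<close> \<open>K \<noteq> {}\<close>] by simp
    qed
    moreover have "\<forall>\<^sub>F n in sequentially.
        (MAX k\<in>K. c (R n) k - \<xi> k u) = (MAX k\<in>L. c (R n) k - \<xi> k u)"
    proof -
      have "\<forall>\<^sub>F n in sequentially. \<eta> l0 z - 1 < c (R n) l0"
        using order_tendstoD(1)[OF fin[OF l0]] by simp
      \<comment> \<open>The thresholds are chosen so that every term outside \<open>L\<close> lies
        below the term of the fixed index \<open>l0\<close>.\<close>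
      with below[of "\<lambda>k. \<eta> l0 z - 1 - \<xi> l0 u + \<xi> k u"] show ?thesis
      proof eventually_elim
        case (elim n)
        then have "c (R n) k - \<xi> k u \<le> c (R n) l0 - \<xi> l0 u" if "k \<in> K - L" for k
          using that by (force simp: algebra_simps)
        then show ?case
          by (rule Max_image_eq_subset[OF \<open>finite K\<close> \<open>L \<subseteq> K\<close> l0])
      qed
    qed
    moreover have "(\<lambda>n. MAX k\<in>L. c (R n) k - \<xi> k u) \<longlonglongrightarrow> (MAX k\<in>L. \<eta> k z - \<xi> k u)"
      by (intro tendsto_Max_image \<open>finite L\<close> \<open>L \<noteq> {}\<close> tendsto_diff fin tendsto_const)
    moreover have "(MAX k\<in>L. \<eta> k z - \<xi> k u) = polyhedral_norm \<xi> L (fst z - u) - snd z"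
    proof -
      have "(MAX k\<in>L. \<eta> k z - \<xi> k u) = (MAX k\<in>L. \<xi> k (fst z - u) + - snd z)"
        using lin \<open>L \<subseteq> K\<close>
        by (intro arg_cong[where f = Max] image_cong) (auto simp: \<eta>_def linear_diff subset_iff)
      then show ?thesis
        unfolding Max_image_add_polyhedral_norm[OF \<open>finite L\<close> \<open>L \<noteq> {}\<close>] by simp
    qed
    ultimately show "(\<lambda>n. polyhedral_norm \<xi> K (p (R n) - u) - polyhedral_norm \<xi> K (p (R n)))
        \<longlonglongrightarrow> polyhedral_norm \<xi> L (fst z - u) - snd z"
      by (simp add: tendsto_cong)
  qed
  \<comment> \<open>Normalization at 0 identifies the remaining constant \<open>snd z\<close> with
    \<open>polyhedral_norm \<xi> L (fst z)\<close>.\<close>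
  have "f 0 = 0" using LIMSEQ_unique[OF lim[of 0], of 0] by simp
  then have "f = (\<lambda>u. polyhedral_norm \<xi> L (fst z - u) - polyhedral_norm \<xi> L (fst z))"
    using f f[of 0] by auto
  moreover have "L = K \<or> dual_face \<xi> K L"
  proof (rule disjCI)
    assume "\<not> dual_face \<xi> K L"
    show "L = K"
    proof (rule ccontr)
      assume "L \<noteq> K"
      \<comment> \<open>As \<open>y (R n)\<close> converges, its values stay bounded below even for
        indices outside \<open>L\<close>, where \<open>c (R n) k\<close> does not.\<close>
      have "\<forall>\<^sub>F n in sequentially. \<forall>k\<in>K. \<eta> k z - 1 < \<eta> k (y (R n))"
        using order_tendstoD(1)[OF \<eta>_lim] \<open>finite K\<close> by (intro eventually_ball_finite) auto
      with below[of "\<lambda>k. \<eta> k z - 1"]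
      have "\<forall>\<^sub>F n in sequentially. \<forall>k\<in>K - L. c (R n) k < \<eta> k (y (R n))"
        by eventually_elim force
      then obtain n where n: "\<forall>k\<in>K - L. c (R n) k < \<eta> k (y (R n))"
        using eventually_happens by fastforce
      txt \<open>Subtracting \<open>y (R n)\<close> makes the functionals \<open>\<eta> k\<close>, \<open>k \<in> L\<close>, vanish exactly, while those
        outside \<open>L\<close> become negative: up to scaling, this is a point defining the dual face \<open>L\<close>.\<close>
      define a where "a = p (R n) - fst (y (R n))"
      define t where "t = polyhedral_norm \<xi> K (p (R n)) - snd (y (R n))"
      have a: "\<xi> k a - t = c (R n) k - \<eta> k (y (R n))" if "k \<in> K" for k
        using lin[OF that] by (simp add: a_def t_def c_def \<eta>_def linear_diff)
      have "dual_face \<xi> K L"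
      proof (rule dual_faceI_strict[OF \<open>finite K\<close> lin pos \<open>L \<noteq> {}\<close>])
        show "L \<subset> K" using \<open>L \<subseteq> K\<close> \<open>L \<noteq> K\<close> by blast
        show "\<xi> k a = t" if "k \<in> L" for k using a[of k] y(1)[OF that] that \<open>L \<subseteq> K\<close> by auto
        show "\<xi> k a < t" if "k \<in> K - L" for k using a[of k] bspec[OF n that] that by simp
      qed
      with \<open>\<not> dual_face \<xi> K L\<close> show False ..
    qed
  qed
  ultimately show ?thesis using that by blast
qed

section \<open>Determination of the horofunctions\<close>

theorem theorem6p2:
  fixes B :: "'a::euclidean_space set"
    and m :: nat
    and K :: "nat set"
    and A :: "nat \<Rightarrow> 'a set"
    and \<xi> :: "nat \<Rightarrow> 'a \<Rightarrow> real"
    and \<nu> :: "'a \<Rightarrow> real"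
  assumes "compact B" and "convex B" and "polyhedron B" and "0 \<in> interior B"
    and K: "K = {0..m}"
    and facets: "bij_betw A K {F. F facet_of B}"
    and \<xi>_linear: "\<And>j. j \<in> K \<Longrightarrow> linear (\<xi> j)"
    and \<xi>_facet: "\<And>j. j \<in> K \<Longrightarrow> A j = {v \<in> B. \<xi> j v = 1}"
    and \<nu>: "\<nu> = polyhedral_norm \<xi> K"
  shows "normalized_horofunctions (asym_metric \<nu>) =
      {(\<lambda>u. \<nu> (p - u) - \<nu> p) |p. True} \<union>
      {(\<lambda>u. polyhedral_norm \<xi> L (p - u) - polyhedral_norm \<xi> L p) |p L. dual_face \<xi> K L}"
proof -
  have finK: "finite K" "K \<noteq> {}" by (auto simp: K)
  \<comment> \<open>Since \<open>B\<close> is bounded, the ray through \<open>a\<close> leaves it at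
    a frontier point. As 0 is interior, this point lies on a facet, where one of the functionals
    equals 1.\<close>
  have pos: "\<exists>k\<in>K. \<xi> k a > 0" if "a \<noteq> 0" for a
  proof -
    obtain d where d: "0 < d" "d *\<^sub>R a \<in> frontier B"
      using ray_to_frontier[OF compact_imp_bounded[OF \<open>compact B\<close>] \<open>0 \<in> interior B\<close> \<open>a \<noteq> 0\<close>]
      by (metis add_0)
    have "d *\<^sub>R a \<in> rel_frontier B"
      using d(2) \<open>0 \<in> interior B\<close> rel_frontier_nonempty_interior[of B] by blast
    then obtain F where F: "F facet_of B" "d *\<^sub>R a \<in> F"
      using rel_frontier_of_polyhedron[OF \<open>polyhedron B\<close>] by blast
    then obtain k where k: "k \<in> K" "d *\<^sub>R a \<in> A k"
      using facets by (auto simp: bij_betw_def)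
    then have "d * \<xi> k a = 1"
      using \<xi>_facet[OF k(1)] \<xi>_linear[OF k(1)] by (simp add: linear_cmul)
    then have "\<xi> k a > 0" using d(1) by (metis zero_less_mult_pos zero_less_one)
    then show ?thesis using k(1) by blast
  qed
  have pc: "(\<lambda>u. polyhedral_norm \<xi> L (p - u) - polyhedral_norm \<xi> L p) \<in> pointed_continuous"
    if "L \<noteq> {}" "L \<subseteq> K" for L p
  proof -
    have "finite L" using that finK finite_subset by blast
    then have "continuous_on UNIV (polyhedral_norm \<xi> L)"
      using that \<xi>_linear by (intro continuous_polyhedral_norm) auto
    then have "continuous_on UNIV (\<lambda>u. polyhedral_norm \<xi> L (p - u))"
      by (rule continuous_on_compose2) (auto intro!: continuous_intros)
    then show ?thesis by (auto simp: pointed_continuous_def intro!: continuous_intros)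
  qed
  let ?h = "\<lambda>L p u. polyhedral_norm \<xi> L (p - u) - polyhedral_norm \<xi> L p"
  have horo: "f \<in> normalized_horofunctions (asym_metric \<nu>) \<longleftrightarrow> f \<in> pointed_continuous \<and>
      (\<forall>S e. bounded S \<longrightarrow> e > 0 \<longrightarrow> (\<exists>p. \<forall>u\<in>S. \<bar>?h K p u - f u\<bar> < e))" for f
    unfolding normalized_horofunctions_def closure_of_bounded_uniform_topology
    using pc[OF finK(2) subset_refl] by (fastforce simp: asym_metric_def \<nu>)
  show ?thesis
  proof (intro subset_antisym subsetI)
    fix f assume f: "f \<in> normalized_horofunctions (asym_metric \<nu>)"
    \<comment> \<open>Approximating on balls of growing radius with shrinking error replaces the
      topological closure by a sequence of points; only its pointwise convergence is needed
      below.\<close>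
    then have "\<exists>p. \<forall>u\<in>cball 0 (real n). \<bar>?h K p u - f u\<bar> < inverse (Suc n)" for n
      unfolding horo by simp
    then obtain p where p: "\<And>n u. u \<in> cball 0 (real n) \<Longrightarrow> \<bar>?h K (p n) u - f u\<bar> < inverse (Suc n)"
      by metis
    have lim: "(\<lambda>n. ?h K (p n) u) \<longlonglongrightarrow> f u" for u
    proof -
      have "\<forall>\<^sub>F n in sequentially. norm u \<le> real n"
        by (rule eventually_sequentiallyI[of "nat \<lceil>norm u\<rceil>"]) linarith
      then have "\<forall>\<^sub>F n in sequentially. norm (?h K (p n) u - f u) \<le> inverse (Suc n)"
        by eventually_elim (use p in \<open>force simp: less_imp_le\<close>)
      then show ?thesis
        by (intro LIM_zero_cancel[OF Lim_null_comparison[OF _ LIMSEQ_inverse_real_of_nat]])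
    qed
    obtain q L where "L = K \<or> dual_face \<xi> K L" "f = ?h L q"
      by (rule horofunction_limit[OF finK, of \<xi> p f]) (simp_all add: \<xi>_linear pos lim)
    then show "f \<in> {(\<lambda>u. \<nu> (p - u) - \<nu> p) |p. True} \<union> {?h L p |p L. dual_face \<xi> K L}"
      unfolding \<nu> by blast
  next
    fix f assume "f \<in> {(\<lambda>u. \<nu> (p - u) - \<nu> p) |p. True} \<union> {?h L p |p L. dual_face \<xi> K L}"
    then consider p where "f = ?h K p" | p L where "dual_face \<xi> K L" "f = ?h L p"
      unfolding \<nu> by blast
    then show "f \<in> normalized_horofunctions (asym_metric \<nu>)"
    proof cases
      case 1
      then show ?thesis
        unfolding horo using pc[OF finK(2) subset_refl]
        by (metis abs_zero diff_self)
    next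
      case 2
      \<comment> \<open>The point \<open>q\<close> depends on \<open>S\<close> but not on
        \<open>e\<close>, as its function equals \<open>f\<close> on \<open>S\<close>.\<close>
      have "\<exists>q. \<forall>u\<in>S. \<bar>?h K q u - f u\<bar> < e" if "bounded S" "e > 0" for S and e :: real
        using horofunction_of_dual_face[OF finK(1) \<xi>_linear 2(1) that(1), of p] that(2) 2(2)
        by (metis abs_zero diff_self)
      moreover have "f \<in> pointed_continuous"
        using pc[of L p] 2 by (auto simp: dual_face_def)
      ultimately show ?thesis unfolding horo by blast
    qed
  qed
qed

end
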